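(* Let $\mathbf{z}=(z_n)$ be a sequence in $\mathbb{D}$ that is regular with respect to $\mathfrak{u}\in\beta\mathbb{N}\setminus\mathbb{N}$. Let $\mathbf{k}=(k_n)$ and $\mathbf{l}=(l_n)$ belong to $\mathtt{Comp}_{\mathfrak{u}}(\mathbf{z})$. If $\lim_{\mathfrak{u}} l_n/k_n = 0$, then $\ker\zeta_{\mathbf{z},\mathfrak{u}}^{\mathbf{k},1}\subsetneq\ker\zeta_{\mathbf{z},\mathfrak{u}}^{\mathbf{l},1}$.
   Context: $\mathbb{K}$ is an algebraically closed field, complete with respect to a nontrivial nonarchimedean absolute value $|\cdot|$; $\mathbb{D} = \{z \in \mathbb{K} : |z|<1\}$; $\mathbb{N}=\{1,2,\dots\}$; $\beta\mathbb{N}\setminus\mathbb{N}$ is the set of nonprincipal ultrafilters in $\mathbb{N}$. $H^\infty$ is the Banach $\mathbb{K}$-algebra of bounded power series $f(z)=\sum_{n\ge 0} a_n z^n$ on $\mathbb{D}$, with norm $\|f\| = \sup_n |a_n| = \sup_{z\in\mathbb{D}}|f(z)|$. For a seminorm $\varphi$ on $H^\infty$, $\ker\varphi = \{f\in H^\infty : \varphi(f)=0\}$. $D^+(z,r)$ is the closed disk with center $z$ and radius $r$, and for a disk $D\subset\mathbb{D}$, $\zeta_D(f) := \sup_{z\in D}|f(z)|$ for $f\in H^\infty$ (a multiplicative seminorm bounded by $\|\cdot\|$). A sequence $\mathbf{z}=(z_n)$ in $\mathbb{D}$ is regular with respect to $\mathfrak{u}$ if there is $C\in\mathfrak{u}$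 with $\inf_{n\in C}\prod_{m\in C, m\ne n}|z_n-z_m|>0$. $\mathtt{Comp}_{\mathfrak{u}}(\mathbf{z})$ is the set of all sequences $\mathbf{k}=(k_n)$ in $\mathbb{N}$ for which there is $C\in\mathfrak{u}$ with $\inf_{n\in C}\prod_{m\in C, m\ne n}|z_n-z_m|^{k_m}>0$. For $\mathbf{k}\in\mathtt{Comp}_{\mathfrak{u}}(\mathbf{z})$ and $r\in(0,1)$, $\zeta_{\mathbf{z},\mathfrak{u}}^{\mathbf{k},r} := \lim_{\mathfrak{u}}\zeta_{D^+(z_n,\sqrt[k_n]{r})}$ (pointwise limit along $\mathfrak{u}$), and $\zeta_{\mathbf{z},\mathfrak{u}}^{\mathbf{k},1} := \lim_{r\to 1^-}\zeta_{\mathbf{z},\mathfrak{u}}^{\mathbf{k},r}$ (pointwise limit, which exists by monotonicity in $r$). *)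

theory Defs
  imports "HOL-Analysis.Analysis" "HOL-Computational_Algebra.Computational_Algebra"
begin

text \<open>
  Algebraically closed fields that are complete with respect to a nontrivial nonarchimedean
  absolute value. (The class \<^class>\<open>real_normed_field\<close> is not usable, as it makes the field
  an algebra over the reals.) Definiteness, i.e. \<open>absv x = 0 \<longleftrightarrow> x = 0\<close>, follows from
  \<open>dist_absv\<close> and the metric axioms.
\<close>

class complete_nonarch_alg_closed_field = alg_closed_field + complete_space +
  fixes absv :: "'a \<Rightarrow> real"
  assumes dist_absv: "dist x y = absv (x - y)"
    and absv_mult: "absv (x * y) = absv x * absv y"
    and absv_add: "absv (x + y) \<le> max (absv x) (absv y)"
    and absv_nontrivial: "\<exists>x. x \<noteq> 0 \<and> absv x \<noteq> 1"

abbreviation unit_disk :: "'a::complete_nonarch_alg_closed_field set"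
  where "unit_disk \<equiv> {z. absv z < 1}"

definition eval_series :: "'a::complete_nonarch_alg_closed_field fps \<Rightarrow> 'a \<Rightarrow> 'a"
  where "eval_series f z = (\<Sum>n. fps_nth f n * z ^ n)"

definition Hinf :: "'a::complete_nonarch_alg_closed_field fps set"
  where "Hinf = {f. (\<forall>z\<in>unit_disk. summable (\<lambda>n. fps_nth f n * z ^ n)) \<and>
                    bdd_above ((\<lambda>z. absv (eval_series f z)) ` unit_disk)}"

definition seminorm_ker :: "('a::complete_nonarch_alg_closed_field fps \<Rightarrow> real) \<Rightarrow> 'a fps set"
  where "seminorm_ker \<phi> = {f \<in> Hinf. \<phi> f = 0}"

definition zeta_disk :: "'a::complete_nonarch_alg_closed_field set \<Rightarrow> 'a fps \<Rightarrow> real"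
  where "zeta_disk D f = (SUP z\<in>D. absv (eval_series f z))"

text \<open>
  Ultrafilters are represented as filters in the sense of the library: a set \<open>C\<close> belongs to
  \<open>u\<close> if and only if \<open>eventually (\<lambda>n. n \<in> C) u\<close>.
\<close>

definition ultrafilter :: "'i filter \<Rightarrow> bool"
  where "ultrafilter u \<longleftrightarrow> u \<noteq> bot \<and> (\<forall>C. eventually (\<lambda>n. n \<in> C) u \<or> eventually (\<lambda>n. n \<notin> C) u)"

definition nonprincipal_ultrafilter :: "'i filter \<Rightarrow> bool"
  where "nonprincipal_ultrafilter u \<longleftrightarrow> ultrafilter u \<and> (\<forall>i. \<not> eventually (\<lambda>n. n = i) u)"

text \<open>
  The product of \<open>a m\<close> over \<open>m \<in> A\<close>, as the limit of its partial products. The library's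
  \<^const>\<open>prodinf\<close> is not suitable: it leaves a product whose partial products tend to \<open>0\<close>
  undefined, whereas the products below may have the value \<open>0\<close>. For sequences in the unit disk
  all factors below lie in \<open>[0, 1)\<close>, so the limit exists.
\<close>

definition inf_prod :: "nat set \<Rightarrow> (nat \<Rightarrow> real) \<Rightarrow> real"
  where "inf_prod A a = lim (\<lambda>N. \<Prod>m\<in>A \<inter> {..<N}. a m)"

definition regular_wrt :: "nat filter \<Rightarrow> (nat \<Rightarrow> 'a::complete_nonarch_alg_closed_field) \<Rightarrow> bool"
  where "regular_wrt u z \<longleftrightarrow>
    (\<exists>C. eventually (\<lambda>n. n \<in> C) u \<and> (INF n\<in>C. inf_prod (C - {n}) (\<lambda>m. absv (z n - z m))) > 0)"

definition Comp :: "nat filter \<Rightarrow> (nat \<Rightarrow> 'a::complete_nonarch_alg_closed_field) \<Rightarrow> (nat \<Rightarrow> nat) set"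
  where "Comp u z = {k. (\<forall>n. k n \<ge> 1) \<and>
    (\<exists>C. eventually (\<lambda>n. n \<in> C) u \<and>
         (INF n\<in>C. inf_prod (C - {n}) (\<lambda>m. absv (z n - z m) ^ k m)) > 0)}"

definition zeta_lim ::
  "nat filter \<Rightarrow> (nat \<Rightarrow> 'a::complete_nonarch_alg_closed_field) \<Rightarrow> (nat \<Rightarrow> nat) \<Rightarrow> real \<Rightarrow> 'a fps \<Rightarrow> real"
  where "zeta_lim u z k r f = Lim u (\<lambda>n. zeta_disk (cball (z n) (root (k n) r)) f)"

definition zeta_lim1 ::
  "nat filter \<Rightarrow> (nat \<Rightarrow> 'a::complete_nonarch_alg_closed_field) \<Rightarrow> (nat \<Rightarrow> nat) \<Rightarrow> 'a fps \<Rightarrow> real"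
  where "zeta_lim1 u z k f = Lim (at_left 1) (\<lambda>r. zeta_lim u z k r f)"

end

theory Submission
  imports Defs
begin

text \<open>
  Write \<open>D(z, r)\<close> for the closed disk. The inclusion holds because \<open>l n / k n \<rightarrow> 0\<close> puts
  \<open>D(z n, s\<^bsup>1/l n\<^esup>)\<close> inside \<open>D(z n, r\<^bsup>1/k n\<^esup>)\<close> for \<open>u\<close>-almost all \<open>n\<close>, whatever \<open>r\<close> and \<open>s\<close> in
  \<open>(0, 1)\<close> are, and because \<open>\<zeta>\<^bsup>k,1\<^esup>\<close>, being a monotone limit, vanishes at \<open>f\<close> if and only if all
  \<open>\<zeta>\<^bsup>k,r\<^esup>\<close> with \<open>r < 1\<close> do (lemmas \<open>zeta_lim_mono\<close> and \<open>zeta_lim1_eq_0_iff\<close>).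

  The inclusion is strict because of a bounded \<open>f\<close> with a zero of order at least \<open>k m\<close> at \<open>z m\<close>,
  for \<open>m\<close> in some \<open>C\<close> in \<open>u\<close>, that is not too small near these points
  (lemma \<open>bounded_product_with_zeros\<close>). Then \<open>\<bar>f w\<bar> \<le> B \<bar>w - z n\<bar>\<^bsup>k n\<^esup>\<close> gives
  \<open>\<bar>f\<bar> \<le> B s\<^bsup>k n / l n\<^esup>\<close> on \<open>D(z n, s\<^bsup>1/l n\<^esup>)\<close>, which tends to \<open>0\<close>; but \<open>\<bar>f\<bar>\<close> is bounded below at
  some point of \<open>D(z n, r\<^bsup>1/k n\<^esup>)\<close>, for a fixed \<open>r\<close>.

  The plain product of the factors \<open>(1 - X / z m)\<^bsup>k m\<^esup>\<close> does not converge, since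
  \<open>\<bar>1 / z m\<bar> \<ge> 1\<close>. As in Weierstrass' theorem, each \<open>1 - X / z m\<close> is multiplied by a polynomial
  \<open>h m\<close> of degree \<open>N m\<close> so that it becomes \<open>1\<close> modulo \<open>X\<^bsup>N m\<^esup>\<close>. If \<open>N\<close> is monotone and unbounded,
  every coefficient of the partial products is eventually constant. This must not spoil the
  bounds, which raises two points.

  The polynomial \<open>h m\<close> has norm \<open>\<bar>z m\<bar>\<^bsup>-N m\<^esup>\<close>. Compatibility of \<open>k\<close> with \<open>z\<close> keeps the products of
  the \<open>\<bar>z m\<bar>\<^bsup>k m\<^esup>\<close> away from \<open>0\<close> (lemma \<open>Comp_separated_center\<close>), that is, the sum of
  \<open>- k m ln \<bar>z m\<bar>\<close> is finite. It remains so after multiplication by \<open>N m\<close> if \<open>N\<close> grows slowly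
  (lemma \<open>exists_unbounded_summable_weights\<close>).

  The polynomial \<open>h m\<close> brings new zeros, all on the circle \<open>\<bar>w\<bar> = \<bar>z m\<bar>\<close>. Only finitely many of
  the points where \<open>f\<close> has to be large lie there. As the residue field is infinite, one coefficient
  of \<open>h m\<close> can be chosen such that \<open>\<bar>h m\<bar> = 1\<close> at these (lemma \<open>exists_generic_conv_factor\<close>).
\<close>

section \<open>Nonarchimedean absolute values\<close>

context
  notes dist_absv [simp]
begin

lemma absv_zero [simp]: "absv (0::'a::complete_nonarch_alg_closed_field) = 0"
  using dist_absv[of "0::'a" 0] by simp

lemma absv_nonneg [simp]: "0 \<le> absv (x::'a::complete_nonarch_alg_closed_field)"
  using dist_absv[of x 0] zero_le_dist[of x 0] by simp

lemma absv_eq_0_iff [simp]: "absv (x::'a::complete_nonarch_alg_closed_field) = 0 \<longleftrightarrow> x = 0"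
  using dist_absv[of x 0] dist_eq_0_iff[of x 0] by simp

lemma absv_pos_iff [simp]: "0 < absv (x::'a::complete_nonarch_alg_closed_field) \<longleftrightarrow> x \<noteq> 0"
  by (simp add: order_less_le)

lemma absv_one [simp]: "absv (1::'a::complete_nonarch_alg_closed_field) = 1"
  using absv_mult[of "1::'a" 1] by simp

lemma absv_uminus [simp]: "absv (- x) = absv (x::'a::complete_nonarch_alg_closed_field)"
  using dist_commute[of x 0] by simp

lemma absv_minus_commute:
  "absv (x - y) = absv (y - x::'a::complete_nonarch_alg_closed_field)"
  using absv_uminus[of "x - y"] by simp

lemma absv_power: "absv (x ^ n) = absv (x::'a::complete_nonarch_alg_closed_field) ^ n"
  by (induction n) (simp_all add: absv_mult)

lemma absv_inverse: "absv (inverse x) = inverse (absv (x::'a::complete_nonarch_alg_closed_field))"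
proof (cases "x = 0")
  case False
  then have "absv (inverse x) * absv x = 1"
    by (simp flip: absv_mult)
  then show ?thesis
    by (metis inverse_unique mult.commute)
qed simp

lemma absv_prod: "absv (prod f A) = (\<Prod>i\<in>A. absv (f i::'a::complete_nonarch_alg_closed_field))"
  by (induction A rule: infinite_finite_induct) (simp_all add: absv_mult)

lemma absv_sum_le:
  fixes f :: "'i \<Rightarrow> 'a::complete_nonarch_alg_closed_field"
  assumes "0 \<le> B" "\<And>i. i \<in> A \<Longrightarrow> absv (f i) \<le> B"
  shows "absv (sum f A) \<le> B"
  using assms(2)
proof (induction A rule: infinite_finite_induct)
  case (insert x F)
  then show ?case
    using absv_add[of "f x" "sum f F"] by force
qed (use assms(1) in auto)

lemma absv_diff_le: "absv (x - y) \<le> max (absv x) (absv (y::'a::complete_nonarch_alg_closed_field))"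
  using absv_add[of x "- y"] by simp

text \<open>In an isosceles triangle the two largest sides are equal.\<close>
lemma absv_add_eq_left:
  assumes "absv y < absv (x::'a::complete_nonarch_alg_closed_field)"
  shows "absv (x + y) = absv x"
  using absv_add[of x y] absv_diff_le[of "x + y" y] assms by (simp add: max_def split: if_splits)

lemma absv_diff_eq_right:
  assumes "absv x < absv (y::'a::complete_nonarch_alg_closed_field)"
  shows "absv (x - y) = absv y"
  using absv_add_eq_left[of x "- y"] assms by (simp add: add.commute)

end

lemma exists_absv_small:
  assumes "0 < d"
  obtains e :: "'a::complete_nonarch_alg_closed_field" where "e \<noteq> 0" "absv e < d" "absv e < 1"
proof -
  obtain x :: 'a where x: "x \<noteq> 0" "absv x \<noteq> 1"
    using absv_nontrivial by blast
  define y where "y = (if absv x < 1 then x else inverse x)"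
  have y: "y \<noteq> 0" "absv y < 1"
    using x by (auto simp: y_def absv_inverse inverse_less_1_iff)
  obtain n where "absv y ^ n < min d 1"
    using real_arch_pow_inv[of "min d 1" "absv y"] y assms by auto
  then show thesis
    using that[of "y ^ n"] y by (simp add: absv_power)
qed

text \<open>
  The residue field of an algebraically closed field is infinite: a root \<open>c\<close> of
  \<open>(X - s\<^sub>1) \<cdots> (X - s\<^sub>n) + 1\<close> is integral, and the product of the \<open>\<bar>c - s\<^sub>i\<bar> \<le> 1\<close> is \<open>1\<close>.
\<close>
lemma exists_residually_distinct:
  fixes S :: "'a::complete_nonarch_alg_closed_field set"
  assumes "finite S" and S: "\<And>s. s \<in> S \<Longrightarrow> absv s \<le> 1"
  obtains c where "absv c \<le> 1" "\<And>s. s \<in> S \<Longrightarrow> absv (c - s) = 1"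
proof (cases "S = {}")
  case True
  then show thesis using that[of 0] by simp
next
  case False
  define p where "p = (\<Prod>s\<in>S. [:-s, 1:]) + 1"
  have "degree (\<Prod>s\<in>S. [:-s, 1:]) = card S"
    by (subst degree_prod_eq_sum_degree) auto
  then have "degree p > 0"
    using False \<open>finite S\<close> by (subst p_def, subst degree_add_eq_left) (auto simp: card_gt_0_iff)
  then obtain c where "poly p c = 0"
    using alg_closed_imp_poly_has_root by blast
  then have "(\<Prod>s\<in>S. c - s) = - 1"
    by (simp add: p_def poly_prod eq_neg_iff_add_eq_0)
  then have prod: "(\<Prod>s\<in>S. absv (c - s)) = 1"
    by (simp flip: absv_prod)
  have c: "absv c \<le> 1"
  proof (rule ccontr)
    assume "\<not> absv c \<le> 1"
    then have "1 < absv (c - s)" if "s \<in> S" for s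
      using absv_diff_eq_right[of s c] S[OF that] by (simp add: absv_minus_commute)
    then have "1 < (\<Prod>s\<in>S. absv (c - s))"
      using False \<open>finite S\<close> by (intro less_1_prod) auto
    then show False using prod by simp
  qed
  have le: "absv (c - s) \<le> 1" if "s \<in> S" for s
    using absv_diff_le[of c s] c S[OF that] by simp
  have "absv (c - s) = 1" if "s \<in> S" for s
  proof (rule antisym[OF le[OF that]])
    have "1 = absv (c - s) * (\<Prod>s\<in>S - {s}. absv (c - s))"
      using prod prod.remove[OF \<open>finite S\<close> that] by metis
    also have "\<dots> \<le> absv (c - s) * 1"
      using le by (intro mult_left_mono prod_le_1) auto
    finally show "1 \<le> absv (c - s)" by simp
  qed
  with c show thesis using that by blast
qed

section \<open>Polynomials and power series with bounded coefficients\<close>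

definition coeffs_bounded :: "'a::complete_nonarch_alg_closed_field poly \<Rightarrow> real \<Rightarrow> bool"
  where "coeffs_bounded p B \<longleftrightarrow> (\<forall>i. absv (coeff p i) \<le> B)"

lemma coeffs_boundedD: "coeffs_bounded p B \<Longrightarrow> absv (coeff p i) \<le> B"
  by (simp add: coeffs_bounded_def)

lemma coeffs_bounded_nonneg: "coeffs_bounded p B \<Longrightarrow> 0 \<le> B"
  using absv_nonneg order_trans unfolding coeffs_bounded_def by blast

lemma coeffs_bounded_one [simp]: "coeffs_bounded 1 1"
  by (simp add: coeffs_bounded_def coeff_1)

lemma coeffs_bounded_mult:
  assumes "coeffs_bounded p A" "coeffs_bounded q B"
  shows "coeffs_bounded (p * q) (A * B)"
proof -
  have "absv (coeff (p * q) i) \<le> A * B" for i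
    unfolding coeff_mult
    using assms[THEN coeffs_bounded_nonneg] assms[THEN coeffs_boundedD]
    by (intro absv_sum_le) (auto simp: absv_mult intro!: mult_mono)
  then show ?thesis by (simp add: coeffs_bounded_def)
qed

lemma coeffs_bounded_power:
  assumes "coeffs_bounded p B"
  shows "coeffs_bounded (p ^ n) (B ^ n)"
  by (induction n) (use assms in \<open>simp_all add: coeffs_bounded_mult\<close>)

lemma coeffs_bounded_prod:
  assumes "\<And>i. i \<in> I \<Longrightarrow> coeffs_bounded (p i) (B i)"
  shows "coeffs_bounded (prod p I) (prod B I)"
  using assms by (induction I rule: infinite_finite_induct) (simp_all add: coeffs_bounded_mult)

lemma coeffs_bounded_poly:
  assumes "coeffs_bounded p B" "absv w \<le> 1"
  shows "absv (poly p w) \<le> B"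
  unfolding poly_altdef
proof (rule absv_sum_le)
  show "0 \<le> B" using assms(1) by (rule coeffs_bounded_nonneg)
  show "absv (coeff p i * w ^ i) \<le> B" for i
    using mult_mono[OF coeffs_boundedD[OF assms(1)] power_le_one[OF absv_nonneg assms(2)], of i i] \<open>0 \<le> B\<close>
    by (simp add: absv_mult absv_power)
qed

text \<open>By the ultrametric inequality and completeness, a series converges once its terms tend to \<open>0\<close>.\<close>
lemma summable_bounded_coeffs:
  fixes a :: "nat \<Rightarrow> 'a::complete_nonarch_alg_closed_field"
  assumes a: "\<And>i. absv (a i) \<le> B" and w: "absv w < 1"
  shows "summable (\<lambda>i. a i * w ^ i)"
proof -
  have B: "0 \<le> B" using a absv_nonneg order_trans by blast
  define S where "S n = (\<Sum>i<n. a i * w ^ i)" for n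
  have *: "dist (S m) (S n) \<le> B * absv w ^ M" if "M \<le> n" "n \<le> m" for m n M
  proof -
    have "S m = S n + (\<Sum>i=n..<m. a i * w ^ i)"
      using that sum.atLeastLessThan_concat[of 0 n m "\<lambda>i. a i * w ^ i"]
      by (simp add: S_def lessThan_atLeast0)
    then have "dist (S m) (S n) = absv (\<Sum>i=n..<m. a i * w ^ i)"
      by (simp add: dist_absv)
    also have "\<dots> \<le> B * absv w ^ M"
      using B w that a
      by (intro absv_sum_le) (auto simp: absv_mult absv_power intro!: mult_mono power_decreasing)
    finally show ?thesis .
  qed
  have "Cauchy S"
  proof (rule metric_CauchyI)
    fix e :: real assume e: "0 < e"
    have "(\<lambda>M. B * absv w ^ M) \<longlonglongrightarrow> B * 0"
      using w by (intro tendsto_intros LIMSEQ_power_zero) simp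
    then obtain M where M: "B * absv w ^ M < e"
      using e order_tendstoD(2)[of _ "B * 0" sequentially e] eventually_happens'[OF sequentially_bot]
      by fastforce
    have "dist (S m) (S n) < e" if "M \<le> m" "M \<le> n" for m n
      using *[of M n m] *[of M m n] M that by (cases "n \<le> m") (auto simp: dist_commute)
    then show "\<exists>M. \<forall>m\<ge>M. \<forall>n\<ge>M. dist (S m) (S n) < e" by blast
  qed
  then have "convergent S" by (rule Cauchy_convergent)
  then show ?thesis
    by (simp add: summable_iff_convergent S_def[abs_def])
qed

text \<open>
  A series is evaluated through polynomials that agree with it to high order, as multiplicativity
  is then needed for polynomials only.
\<close>
lemma eval_series_approx:
  fixes f :: "'a::complete_nonarch_alg_closed_field fps"
  assumes f: "\<And>i. absv (fps_nth f i) \<le> B" and p: "coeffs_bounded p B"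
    and agree: "\<And>i. i < N \<Longrightarrow> fps_nth f i = coeff p i" and w: "absv w < 1"
  shows "absv (eval_series f w - poly p w) \<le> B * absv w ^ N"
proof -
  have B: "0 \<le> B" using p by (rule coeffs_bounded_nonneg)
  have "(\<lambda>n. \<Sum>i<n. fps_nth f i * w ^ i) \<longlonglongrightarrow> eval_series f w"
    unfolding eval_series_def
    using summable_LIMSEQ[OF summable_bounded_coeffs[of "fps_nth f", OF f w]] .
  then have lim: "(\<lambda>n. dist (\<Sum>i<n. fps_nth f i * w ^ i) (poly p w))
      \<longlonglongrightarrow> dist (eval_series f w) (poly p w)"
    by (intro tendsto_intros)
  have "dist (\<Sum>i<n. fps_nth f i * w ^ i) (poly p w) \<le> B * absv w ^ N" if "degree p < n" for n
  proof -
    have "poly p w = (\<Sum>i<n. coeff p i * w ^ i)"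
      unfolding poly_altdef using that
      by (intro sum.mono_neutral_left) (auto simp: coeff_eq_0)
    then have "dist (\<Sum>i<n. fps_nth f i * w ^ i) (poly p w)
        = absv (\<Sum>i<n. (fps_nth f i - coeff p i) * w ^ i)"
      by (simp add: dist_absv sum_subtractf left_diff_distrib)
    also have "\<dots> \<le> B * absv w ^ N"
    proof (rule absv_sum_le)
      fix i
      show "absv ((fps_nth f i - coeff p i) * w ^ i) \<le> B * absv w ^ N"
      proof (cases "i < N")
        case True
        then show ?thesis using agree B by simp
      next
        case False
        have "absv (fps_nth f i - coeff p i) \<le> B"
          using absv_diff_le[of "fps_nth f i" "coeff p i"] f[of i] coeffs_boundedD[OF p, of i] by simp
        then show ?thesis
          using False w B unfolding absv_mult absv_power
          by (intro mult_mono power_decreasing) auto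
      qed
    qed (use B in simp)
    finally show ?thesis .
  qed
  then have "dist (eval_series f w) (poly p w) \<le> B * absv w ^ N"
    by (intro LIMSEQ_le_const2[OF lim]) (metis less_eq_Suc_le)
  then show ?thesis by (simp add: dist_absv)
qed

lemma bounded_coeffs_in_Hinf:
  fixes f :: "'a::complete_nonarch_alg_closed_field fps"
  assumes f: "\<And>i. absv (fps_nth f i) \<le> B"
  shows "f \<in> Hinf"
proof -
  have "0 \<le> B" using f absv_nonneg order_trans by blast
  then have "absv (eval_series f w) \<le> B" if "absv w < 1" for w
    using eval_series_approx[OF f, of 0 0 w] that by (simp add: coeffs_bounded_def)
  then show ?thesis
    using summable_bounded_coeffs[of "fps_nth f", OF f] by (auto simp: Hinf_def bdd_above_def)
qed

section \<open>Infinite products and slowly growing weights\<close>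

text \<open>A product of \<open>j\<close> factors not exceeding \<open>\<rho> < 1\<close> is at most \<open>\<rho>\<^bsup>j\<^esup>\<close>, hence below \<open>\<delta>\<close> for large \<open>j\<close>.\<close>
lemma finite_if_prod_bounded_below:
  fixes g :: "'i \<Rightarrow> real"
  assumes \<rho>: "0 \<le> \<rho>" "\<rho> < 1" and \<delta>: "0 < \<delta>"
    and g: "\<And>i. i \<in> A \<Longrightarrow> 0 \<le> g i \<and> g i \<le> \<rho>"
    and prod: "\<And>F. finite F \<Longrightarrow> F \<subseteq> A \<Longrightarrow> \<delta> \<le> prod g F"
  shows "finite A"
proof (rule ccontr)
  assume inf: "infinite A"
  obtain j where j: "\<rho> ^ j < \<delta>"
    using real_arch_pow_inv[OF \<delta>, of \<rho>] \<rho> by auto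
  obtain F where F: "F \<subseteq> A" "finite F" "card F = j"
    using infinite_arbitrarily_large[OF inf] by blast
  have "\<delta> \<le> prod g F"
    using F by (intro prod) auto
  also have "\<dots> \<le> (\<Prod>i\<in>F. \<rho>)"
    using g F by (intro prod_mono) auto
  finally show False using F j by simp
qed

text \<open>
  A convergent series stays convergent with suitable unbounded weights (Abel and Dini): if
  \<open>T m\<close> are the tails, then \<open>a m / sqrt (T m) \<le> 2 (sqrt (T m) - sqrt (T (m + 1)))\<close> telescopes.
\<close>
lemma exists_unbounded_summable_weights:
  fixes a :: "nat \<Rightarrow> real"
  assumes nonneg: "\<And>m. 0 \<le> a m" and "summable a"
  obtains N :: "nat \<Rightarrow> nat" and L where "mono N" "\<And>m. 1 \<le> N m" "filterlim N at_top at_top"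
    "\<And>F. finite F \<Longrightarrow> (\<Sum>m\<in>F. real (N m) * a m) \<le> L"
proof -
  \<comment> \<open>the geometric series makes the tails positive\<close>
  define a' where "a' m = a m + (1/2) ^ m" for m
  have pos: "0 < a' m" for m
    using nonneg[of m] by (simp add: a'_def add_nonneg_pos)
  have summ: "summable a'"
    unfolding a'_def using assms(2) by (intro summable_add summable_geometric) auto
  define T where "T m = (\<Sum>j. a' (j + m))" for m
  have T_pos: "0 < T m" for m
    unfolding T_def using pos summ by (intro suminf_pos) (simp_all add: summable_ignore_initial_segment)
  have T_eq: "T m = suminf a' - sum a' {..<m}" for m
    unfolding T_def by (rule suminf_minus_initial_segment[OF summ])
  have T_step: "T m - T (Suc m) = a' m" for m
    by (simp add: T_eq)
  have "T \<longlonglongrightarrow> suminf a' - suminf a'"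
    unfolding T_eq[abs_def] by (intro tendsto_intros summable_LIMSEQ summ)
  then have T_lim: "T \<longlonglongrightarrow> 0" by simp
  have T_decr: "T n \<le> T m" if "m \<le> n" for m n
    using that pos unfolding T_eq by (intro diff_left_mono sum_mono2) (auto intro: less_imp_le)
  define N where "N m = nat \<lfloor>1 / sqrt (T m)\<rfloor> + 1" for m
  have "mono N"
    unfolding N_def using T_decr T_pos
    by (intro monoI add_mono nat_mono floor_mono divide_left_mono) (auto intro!: mult_pos_pos)
  moreover have "filterlim N at_top at_top"
  proof -
    have "filterlim (\<lambda>m. inverse (sqrt (T m))) at_top sequentially"
      using T_pos tendsto_real_sqrt[OF T_lim] by (intro filterlim_inverse_at_top) auto
    then have "filterlim (\<lambda>m. real (N m)) at_top sequentially"
    proof (rule filterlim_at_top_mono)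
      have "inverse (sqrt (T m)) \<le> real (N m)" for m
        using T_pos[of m] by (simp add: N_def divide_inverse) linarith
      then show "\<forall>\<^sub>F m in sequentially. inverse (sqrt (T m)) \<le> real (N m)" by simp
    qed
    then show ?thesis
      by (simp add: filterlim_sequentially_iff_filterlim_real)
  qed
  moreover have "(\<Sum>m\<in>F. real (N m) * a m) \<le> 2 * sqrt (T 0) + T 0" if "finite F" for F
  proof -
    have le: "real (N m) * a m
        \<le> (2 * sqrt (T m) + T m) - (2 * sqrt (T (Suc m)) + T (Suc m))" for m
    proof -
      define p where "p = sqrt (T m)"
      define q where "q = sqrt (T (Suc m))"
      have pq: "0 < p" "0 < q" "q \<le> p" "T m = p\<^sup>2" "T (Suc m) = q\<^sup>2"
        using T_pos[of m] T_pos[of "Suc m"] T_decr[of m "Suc m"] by (auto simp: p_def q_def)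
      have am: "a' m = (p - q) * (p + q)"
        using T_step[of m] pq by (simp add: power2_eq_square algebra_simps)
      have "real (N m) * a m \<le> (1 / p + 1) * a' m"
      proof (rule mult_mono)
        show "real (N m) \<le> 1 / p + 1"
          using pq by (simp add: N_def flip: p_def)
        show "a m \<le> a' m" by (simp add: a'_def)
      qed (use nonneg pq in auto)
      also have "\<dots> = a' m / p + a' m" using pq by (simp add: field_simps)
      also have "a' m / p \<le> 2 * (p - q)"
      proof -
        have "(p - q) * (p + q) \<le> (p - q) * (2 * p)"
          using pq by (intro mult_left_mono) auto
        then show ?thesis using pq by (simp only: am pos_divide_le_eq mult_ac)
      qed
      finally show ?thesis
        using T_step[of m] by (simp add: p_def q_def)
    qed
    obtain M where M: "F \<subseteq> {..<M}"
      using \<open>finite F\<close> finite_nat_iff_bounded[of F] by auto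
    have "(\<Sum>m\<in>F. real (N m) * a m) \<le> (\<Sum>m<M. real (N m) * a m)"
      using M nonneg by (intro sum_mono2) auto
    also have "\<dots> \<le> (\<Sum>m<M. (2 * sqrt (T m) + T m) - (2 * sqrt (T (Suc m)) + T (Suc m)))"
      by (intro sum_mono le)
    also have "\<dots> = (2 * sqrt (T 0) + T 0) - (2 * sqrt (T M) + T M)"
      by (rule sum_lessThan_telescope')
    also have "\<dots> \<le> 2 * sqrt (T 0) + T 0"
      using T_pos[of M] real_sqrt_gt_zero[OF T_pos[of M]] by linarith
    finally show ?thesis .
  qed
  moreover have "1 \<le> N m" for m by (simp add: N_def)
  ultimately show thesis by (intro that[of N "2 * sqrt (T 0) + T 0"]) auto
qed

section \<open>Convergence factors\<close>

text \<open>
  The truncated geometric series of \<open>1 / (1 - b X)\<close>, with the coefficient \<open>c\<close> as a free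
  parameter in degree \<open>N\<close>.
\<close>
definition conv_factor :: "nat \<Rightarrow> 'a \<Rightarrow> 'a \<Rightarrow> 'a::complete_nonarch_alg_closed_field poly"
  where "conv_factor N b c = (\<Sum>i<N. monom (b ^ i) i) + monom (c * b ^ N) N"

lemma poly_conv_factor: "poly (conv_factor N b c) w = (\<Sum>i<N. (b * w) ^ i) + c * (b * w) ^ N"
  by (simp add: conv_factor_def poly_sum poly_monom power_mult_distrib mult.assoc)

lemma coeffs_bounded_conv_factor:
  assumes "1 \<le> absv b" "absv c \<le> 1"
  shows "coeffs_bounded (conv_factor N b c) (absv b ^ N)"
  unfolding coeffs_bounded_def
proof
  fix i
  have "coeff (conv_factor N b c) i = (if i < N then b ^ i else if i = N then c * b ^ N else 0)"
    by (auto simp: conv_factor_def coeff_sum sum.delta)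
  then show "absv (coeff (conv_factor N b c) i) \<le> absv b ^ N"
    using assms by (auto simp: absv_mult absv_power power_increasing mult_left_le_one_le)
qed

text \<open>The geometric sum telescopes; all that remains besides \<open>1\<close> has degree at least \<open>N\<close>.\<close>
lemma linear_times_conv_factor:
  "[:1, - b:] * conv_factor N b c = 1 + monom 1 N * smult (b ^ N) [:c - 1, - (c * b):]"
proof -
  define X where "X = monom b 1"
  have lin: "[:1, - b:] = 1 - X"
    by (simp add: X_def monom_altdef one_pCons)
  have X: "X ^ N = monom (b ^ N) N"
    by (simp add: X_def monom_power)
  have "conv_factor N b c = (\<Sum>i<N. X ^ i) + [:c:] * X ^ N"
    by (simp add: conv_factor_def X_def monom_power smult_monom)
  then have "[:1, - b:] * conv_factor N b c = (1 - X) * (\<Sum>i<N. X ^ i) + (1 - X) * [:c:] * X ^ N"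
    by (simp add: lin algebra_simps)
  also have "\<dots> = 1 + X ^ N * ((1 - X) * [:c:] - 1)"
    by (simp only: one_diff_power_eq[symmetric]) (simp add: algebra_simps)
  also have "(1 - X) * [:c:] - 1 = [:c - 1, - (c * b):]"
    by (simp flip: lin) (simp add: one_pCons)
  also have "X ^ N = monom 1 N * [:b ^ N:]"
    by (simp add: X smult_monom)
  finally show ?thesis by (simp add: mult_ac)
qed

text \<open>
  The term of largest absolute value decides, unless \<open>\<bar>b w\<bar> = 1\<close>; that case is left to the choice
  of \<open>c\<close>.
\<close>
lemma absv_conv_factor_ge_1:
  assumes "1 \<le> N" "absv c = 1"
    and generic: "absv (b * w) = 1 \<Longrightarrow> absv (c + (\<Sum>i<N. (b * w) ^ i) * inverse ((b * w) ^ N)) = 1"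
  shows "1 \<le> absv (poly (conv_factor N b c) w)"
proof -
  define t where "t = b * w"
  define S where "S = (\<Sum>i<N. t ^ i)"
  have eq: "poly (conv_factor N b c) w = S + c * t ^ N"
    by (simp add: poly_conv_factor S_def t_def)
  consider "absv t < 1" | "absv t = 1" | "1 < absv t" by linarith
  then show ?thesis
  proof cases
    case 1
    define R where "R = (\<Sum>i=1..<N. t ^ i) + c * t ^ N"
    have S: "S = 1 + (\<Sum>i=1..<N. t ^ i)"
      using \<open>1 \<le> N\<close> by (simp add: S_def lessThan_atLeast0 sum.atLeast_Suc_lessThan)
    have pow: "absv (t ^ i) \<le> absv t" if "1 \<le> i" for i
      using power_decreasing[OF that, of "absv t"] 1 by (simp add: absv_power)
    have "absv R \<le> max (absv (\<Sum>i=1..<N. t ^ i)) (absv (c * t ^ N))"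
      unfolding R_def by (rule absv_add)
    also have "\<dots> \<le> absv t"
      using pow assms(1,2) by (auto intro!: absv_sum_le simp: absv_mult)
    finally have "absv (1 + R) = 1"
      using absv_add_eq_left[of R 1] 1 by simp
    then show ?thesis by (simp add: eq S R_def add.assoc)
  next
    case 2
    then have "t \<noteq> 0" by auto
    then have "S + c * t ^ N = (c + S * inverse (t ^ N)) * t ^ N"
      by (simp add: field_simps)
    then show ?thesis
      using generic 2 by (simp add: eq absv_mult absv_power S_def t_def)
  next
    case 3
    have "absv S \<le> absv t ^ (N - 1)"
      unfolding S_def using 3 by (intro absv_sum_le) (auto simp: absv_power intro!: power_increasing)
    also have "\<dots> < absv (c * t ^ N)"
      using 3 assms(1,2) by (auto simp: absv_mult absv_power intro!: power_strict_increasing)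
    finally have "absv (c * t ^ N + S) = absv t ^ N"
      using absv_add_eq_left[of S "c * t ^ N"] assms(2) by (simp add: absv_mult absv_power)
    then show ?thesis
      using 3 by (simp add: eq add.commute one_le_power)
  qed
qed

text \<open>
  At \<open>t = b w\<close> with \<open>\<bar>t\<bar> = 1\<close> the factor is \<open>t\<^bsup>N\<^esup> (c - s w)\<close> with \<open>\<bar>s w\<bar> \<le> 1\<close>, so \<open>c\<close> has to avoid
  the residue classes of finitely many \<open>s w\<close>, and that of \<open>0\<close>.
\<close>
lemma exists_generic_conv_factor:
  fixes b :: "'a::complete_nonarch_alg_closed_field"
  assumes "finite W" "1 \<le> N"
  obtains c where "absv c = 1"
    "\<And>w. absv (b * w) = 1 \<longrightarrow> w \<in> W \<Longrightarrow> 1 \<le> absv (poly (conv_factor N b c) w)"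
proof -
  define s where "s w = - ((\<Sum>i<N. (b * w) ^ i) * inverse ((b * w) ^ N))" for w
  define W' where "W' = {w \<in> W. absv (b * w) = 1}"
  have "absv (s w) \<le> 1" if "w \<in> W'" for w
    using that unfolding W'_def s_def
    by (auto simp: absv_mult[of _ "inverse _"] absv_inverse absv_power intro!: absv_sum_le)
  then have "absv t \<le> 1" if "t \<in> insert 0 (s ` W')" for t
    using that by auto
  moreover have "finite (insert 0 (s ` W'))"
    using assms(1) by (simp add: W'_def)
  ultimately obtain c where c: "\<And>t. t \<in> insert 0 (s ` W') \<Longrightarrow> absv (c - t) = 1"
    using exists_residually_distinct by metis
  show thesis
  proof (rule that)
    show c1: "absv c = 1" using c[of 0] by simp
    fix w assume "absv (b * w) = 1 \<longrightarrow> w \<in> W"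
    then show "1 \<le> absv (poly (conv_factor N b c) w)"
      using c[of "s w"] c1 \<open>1 \<le> N\<close> by (intro absv_conv_factor_ge_1) (auto simp: W'_def s_def)
  qed
qed

section \<open>A bounded power series with prescribed zeros\<close>

lemma one_plus_monom_multiple_power:
  fixes p :: "'a::comm_ring_1 poly"
  shows "monom 1 N dvd (1 + monom 1 N * p) ^ k - 1"
proof -
  have "monom 1 N dvd (1 - (1 + monom 1 N * p) ^ k)"
    unfolding one_diff_power_eq by simp
  then show ?thesis by (simp only: dvd_minus_iff[of _ "1 - _", symmetric] minus_diff_eq)
qed

text \<open>
  The points \<open>z n + x n\<close>, where the series is bounded below, are closer to \<open>z n\<close> than any other
  \<open>z m\<close> and than the origin: \<open>\<bar>z m - z n\<bar>\<^bsup>k n\<^esup>\<close> is a one-factor instance of the product centered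
  at \<open>z m\<close>, hence at least \<open>\<delta> > \<epsilon>\<close>. So \<open>z n + x n\<close> and \<open>z n\<close> have the same absolute value and
  the same distance from each \<open>z m\<close> with \<open>m \<noteq> n\<close>, and the separation hypothesis bounds the product
  from below there.
\<close>
lemma bounded_product_with_zeros:
  fixes z x :: "nat \<Rightarrow> 'a::complete_nonarch_alg_closed_field" and k :: "nat \<Rightarrow> nat"
  assumes z: "\<And>n. n \<in> C \<Longrightarrow> absv (z n) < 1"
    and k: "\<And>n. n \<in> C \<Longrightarrow> 1 \<le> k n"
    and center: "\<And>F. finite F \<Longrightarrow> F \<subseteq> C \<Longrightarrow> \<delta> \<le> (\<Prod>m\<in>F. absv (z m) ^ k m)"
    and sep: "\<And>n F. n \<in> C \<Longrightarrow> finite F \<Longrightarrow> F \<subseteq> C - {n}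
                \<Longrightarrow> \<delta> \<le> (\<Prod>m\<in>F. absv (z n - z m) ^ k m)"
    and x: "\<And>n. n \<in> C \<Longrightarrow> absv (x n) ^ k n = \<epsilon>"
    and \<epsilon>: "0 < \<epsilon>" "\<epsilon> < \<delta>"
  obtains f B where "f \<in> Hinf"
    "\<And>n w. n \<in> C \<Longrightarrow> absv w < 1 \<Longrightarrow> absv (eval_series f w) \<le> B * absv (w - z n) ^ k n"
    "\<And>n. n \<in> C \<Longrightarrow> \<epsilon> * \<delta> \<le> absv (eval_series f (z n + x n))"
proof -
  have \<delta>: "0 < \<delta>" using \<epsilon> by simp
  have z_pow: "\<delta> \<le> absv (z n) ^ k n" if "n \<in> C" for n
    using center[of "{n}"] that by simp
  have z_nz: "z n \<noteq> 0" if "n \<in> C" for n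
    using z_pow[OF that] k[OF that] \<delta> by (auto simp: power_0_left)
  have x_z: "absv (x n) < absv (z n)" if "n \<in> C" for n
    using x[OF that] z_pow[OF that] \<epsilon> by (simp add: power_less_imp_less_base[of _ "k n"])
  define w where "w n = z n + x n" for n
  have w: "absv (w n) = absv (z n)" if "n \<in> C" for n
    unfolding w_def using x_z[OF that] by (rule absv_add_eq_left)
  have w_z: "absv (w n - z m) = absv (z n - z m)" if "n \<in> C" "m \<in> C" "m \<noteq> n" for m n
  proof -
    have "\<delta> \<le> absv (z m - z n) ^ k n"
      using sep[of m "{n}"] that by simp
    then have "absv (x n) < absv (z n - z m)"
      using x[OF that(1)] \<epsilon>
      by (simp add: power_less_imp_less_base[of _ "k n"] absv_minus_commute)
    then have "absv ((z n - z m) + x n) = absv (z n - z m)"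
      by (rule absv_add_eq_left)
    then show ?thesis by (simp add: w_def algebra_simps)
  qed

  \<comment> \<open>the degrees of the convergence factors\<close>
  define a where "a m = (if m \<in> C then real (k m) * - ln (absv (z m)) else 0)" for m
  have a_nonneg: "0 \<le> a m" for m
    using z[of m] z_nz[of m] by (auto simp: a_def intro!: mult_nonneg_nonpos)
  have "summable a"
  proof (rule summableI_nonneg_bounded[OF a_nonneg])
    fix M
    let ?F = "C \<inter> {..<M}"
    have "ln \<delta> \<le> ln (\<Prod>m\<in>?F. absv (z m) ^ k m)"
      using center[of ?F] \<delta> by (intro ln_mono) auto
    also have "\<dots> = (\<Sum>m\<in>?F. ln (absv (z m) ^ k m))"
      using z_nz by (intro ln_prod) auto
    also have "\<dots> = - (\<Sum>m\<in>?F. a m)"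
      using z_nz by (simp add: a_def ln_realpow flip: sum_negf)
    also have "(\<Sum>m\<in>?F. a m) = sum a {..<M}"
      by (intro sum.mono_neutral_left) (auto simp: a_def)
    finally show "sum a {..<M} \<le> - ln \<delta>" by simp
  qed
  obtain N :: "nat \<Rightarrow> nat" and L where N: "mono N" "\<And>m. 1 \<le> N m" "filterlim N at_top at_top"
    and L: "\<And>F. finite F \<Longrightarrow> (\<Sum>m\<in>F. real (N m) * a m) \<le> L"
    using exists_unbounded_summable_weights[OF a_nonneg \<open>summable a\<close>] by blast

  define b where "b m = inverse (z m)" for m
  have b: "1 \<le> absv (b m)" "absv (b m) * absv (z m) = 1" if "m \<in> C" for m
    using z[OF that] z_nz[OF that] by (auto simp: b_def absv_inverse one_le_inverse)
  have finite_circle: "finite {n \<in> C. absv (z n) = \<rho>}" if \<rho>: "0 \<le> \<rho>" "\<rho> < 1" for \<rho>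
  proof (rule finite_if_prod_bounded_below[OF \<rho> \<delta>])
    show "\<delta> \<le> (\<Prod>m\<in>F. absv (z m) ^ k m)" if "finite F" "F \<subseteq> {n \<in> C. absv (z n) = \<rho>}" for F
      using that by (intro center) auto
    fix m assume "m \<in> {n \<in> C. absv (z n) = \<rho>}"
    then have m: "m \<in> C" "absv (z m) = \<rho>" by auto
    then show "0 \<le> absv (z m) ^ k m \<and> absv (z m) ^ k m \<le> \<rho>"
      using power_decreasing[OF k[OF m(1)], of \<rho>] \<rho> by simp
  qed
  have "\<exists>c. absv c = 1 \<and> (\<forall>n\<in>C. 1 \<le> absv (poly (conv_factor (N m) (b m) c) (w n)))"
    if m: "m \<in> C" for m
  proof -
    define W where "W = w ` {n \<in> C. absv (z n) = absv (z m)}"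
    have "finite W"
      unfolding W_def using z[OF m] by (intro finite_imageI finite_circle) auto
    obtain c where c: "absv c = 1"
      "\<And>v. absv (b m * v) = 1 \<longrightarrow> v \<in> W \<Longrightarrow> 1 \<le> absv (poly (conv_factor (N m) (b m) c) v)"
      using exists_generic_conv_factor[OF \<open>finite W\<close> N(2)] by blast
    have "absv (b m * w n) = 1 \<longrightarrow> w n \<in> W" if "n \<in> C" for n
    proof
      assume "absv (b m * w n) = 1"
      then have "absv (b m) * absv (z n) = absv (b m) * absv (z m)"
        using w[OF that] b[OF m] by (simp add: absv_mult)
      then have "absv (z n) = absv (z m)"
        using b(1)[OF m] by auto
      then show "w n \<in> W" using that by (auto simp: W_def)
    qed
    then show ?thesis using c by blast
  qed
  then obtain c where c: "\<And>m. m \<in> C \<Longrightarrow> absv (c m) = 1"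
    and lower: "\<And>m n. m \<in> C \<Longrightarrow> n \<in> C \<Longrightarrow> 1 \<le> absv (poly (conv_factor (N m) (b m) (c m)) (w n))"
    by metis

  define h where "h m = conv_factor (N m) (b m) (c m)" for m
  define E where "E m = [:1, - b m:] * h m" for m
  define P where "P M = (\<Prod>m\<in>C \<inter> {..<M}. E m ^ k m)" for M
  have linear: "absv (poly [:1, - b m:] v) = absv (b m) * absv (v - z m)" if "m \<in> C" for m v
  proof -
    have "poly [:1, - b m:] v = - (b m * (v - z m))"
      using z_nz[OF that] by (simp add: b_def algebra_simps)
    then show ?thesis by (simp add: absv_mult)
  qed

  \<comment> \<open>a bound for the coefficients of all partial products\<close>
  define \<beta> where "\<beta> m = (absv (b m) * absv (b m) ^ N m) ^ k m" for m
  have h_bound: "coeffs_bounded (h m) (absv (b m) ^ N m)" if "m \<in> C" for m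
    unfolding h_def using b(1)[OF that] c[OF that] by (intro coeffs_bounded_conv_factor) auto
  have E_bound: "coeffs_bounded (E m ^ k m) (\<beta> m)" if m: "m \<in> C" for m
  proof -
    have "coeffs_bounded [:1, - b m:] (absv (b m))"
      using b(1)[OF m] by (auto simp: coeffs_bounded_def coeff_pCons split: nat.split)
    then show ?thesis
      unfolding E_def \<beta>_def using h_bound[OF m]
      by (intro coeffs_bounded_power coeffs_bounded_mult)
  qed
  define B where "B = exp (2 * L)"
  have \<beta>: "(\<Prod>m\<in>F. \<beta> m) \<le> B" if F: "finite F" "F \<subseteq> C" for F
  proof -
    have "(\<Prod>m\<in>F. \<beta> m) \<le> (\<Prod>m\<in>F. exp (2 * (real (N m) * a m)))"
    proof (intro prod_mono conjI)
      fix m assume "m \<in> F"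
      then have m: "m \<in> C" using F by auto
      have "absv (b m) = exp (- ln (absv (z m)))"
        using z_nz[OF m] by (simp add: b_def absv_inverse exp_minus)
      then have "\<beta> m = exp (real (k m * Suc (N m)) * - ln (absv (z m)))"
        unfolding \<beta>_def exp_of_nat_mult by (simp flip: power_Suc power_mult add: mult.commute)
      also have "real (k m * Suc (N m)) * - ln (absv (z m)) = real (Suc (N m)) * a m"
        using m by (simp add: a_def algebra_simps)
      also have "\<dots> \<le> real (2 * N m) * a m"
        using N(2)[of m] a_nonneg[of m] by (intro mult_right_mono) auto
      finally show "\<beta> m \<le> exp (2 * (real (N m) * a m))" by (simp add: mult.assoc)
    qed (simp add: \<beta>_def)
    also have "\<dots> = exp (2 * (\<Sum>m\<in>F. real (N m) * a m))"
      using F by (simp add: exp_sum sum_distrib_left)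
    also have "\<dots> \<le> B" using L[OF F(1)] by (simp add: B_def)
    finally show ?thesis .
  qed
  have P_bound: "coeffs_bounded (P M) B" for M
  proof -
    have "coeffs_bounded (P M) (\<Prod>m\<in>C \<inter> {..<M}. \<beta> m)"
      unfolding P_def using E_bound by (intro coeffs_bounded_prod) auto
    then show ?thesis
      using \<beta>[of "C \<inter> {..<M}"] order_trans unfolding coeffs_bounded_def by fastforce
  qed

  \<comment> \<open>every coefficient is eventually constant along the partial products\<close>
  have stable: "monom 1 (N M) dvd P M' - P M" if "M \<le> M'" for M M'
    using that
  proof (induction M' rule: dec_induct)
    case (step M')
    have "monom 1 (N M) dvd P (Suc M') - P M'"
    proof (cases "M' \<in> C")
      case True
      then have "C \<inter> {..<Suc M'} = insert M' (C \<inter> {..<M'})"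
        by (auto simp: less_Suc_eq)
      then have "P (Suc M') - P M' = (E M' ^ k M' - 1) * P M'"
        by (simp add: P_def algebra_simps)
      moreover have "monom 1 (N M') dvd E M' ^ k M' - 1"
        unfolding E_def h_def linear_times_conv_factor by (rule one_plus_monom_multiple_power)
      moreover have "monom 1 (N M) dvd (monom 1 (N M') :: 'a poly)"
        using monoD[OF N(1) step.hyps(1)] by (simp add: monom_1_dvd_iff' )
      ultimately show ?thesis by (metis dvd_mult2 dvd_trans)
    next
      case False
      then have "C \<inter> {..<Suc M'} = C \<inter> {..<M'}"
        by (auto simp: less_Suc_eq)
      then show ?thesis by (simp add: P_def)
    qed
    then have "monom 1 (N M) dvd (P (Suc M') - P M') + (P M' - P M)"
      using step.IH by (rule dvd_add)
    then show ?case by simp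
  qed simp
  have stable_coeff: "coeff (P M') i = coeff (P M) i" if "M \<le> M'" "i < N M" for M M' i
    using stable[OF that(1)] that(2) by (simp add: monom_1_dvd_iff')
  have "\<exists>M. i < N M" for i
    using eventually_happens'[OF sequentially_bot filterlim_at_top[THEN iffD1, OF N(3), rule_format, of "Suc i"]]
    by (auto simp: Suc_le_eq)
  then obtain \<mu> where \<mu>: "\<And>i. i < N (\<mu> i)" by metis
  define f where "f = Abs_fps (\<lambda>i. coeff (P (\<mu> i)) i)"
  have f_coeff: "fps_nth f i = coeff (P M) i" if "i < N M" for i M
    using stable_coeff[of M "\<mu> i" i] stable_coeff[of "\<mu> i" M i] that \<mu>[of i]
    by (cases "M \<le> \<mu> i") (simp_all add: f_def)
  have f_bound: "absv (fps_nth f i) \<le> B" for i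
    using coeffs_boundedD[OF P_bound] by (simp add: f_def)
  have f_lim: "(\<lambda>M. absv (poly (P M) v)) \<longlonglongrightarrow> absv (eval_series f v)" if v: "absv v < 1" for v
  proof -
    have "(\<lambda>M. absv v ^ N M) \<longlonglongrightarrow> 0"
      using filterlim_compose[OF LIMSEQ_power_zero[of "absv v"] N(3)] v by simp
    then have lim0: "(\<lambda>M. B * absv v ^ N M) \<longlonglongrightarrow> 0"
      by (rule tendsto_mult_right_zero)
    have "dist (poly (P M) v) (eval_series f v) \<le> B * absv v ^ N M" for M
      using eval_series_approx[OF f_bound P_bound f_coeff v] by (simp add: dist_absv absv_minus_commute)
    then have "(\<lambda>M. dist (poly (P M) v) (eval_series f v)) \<longlonglongrightarrow> 0"
      by (intro tendsto_sandwich[OF _ _ tendsto_const lim0]) auto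
    then have "(\<lambda>M. poly (P M) v) \<longlonglongrightarrow> eval_series f v"
      by (simp only: tendsto_dist_iff[symmetric])
    then have "(\<lambda>M. dist (poly (P M) v) 0) \<longlonglongrightarrow> dist (eval_series f v) 0"
      by (intro tendsto_intros)
    then show ?thesis by (simp add: dist_absv)
  qed

  show thesis
  proof (rule that)
    show "f \<in> Hinf" by (rule bounded_coeffs_in_Hinf[OF f_bound])
  next
    fix n v assume n: "n \<in> C" and v: "absv (v::'a) < 1"
    have "absv (poly (P M) v) \<le> B * absv (v - z n) ^ k n" if M: "Suc n \<le> M" for M
    proof -
      let ?F = "C \<inter> {..<M}"
      \<comment> \<open>splitting off the zero at \<open>z n\<close> leaves \<open>h n ^ k n * G\<close>, bounded by its coefficients\<close>
      define G where "G = (\<Prod>m\<in>?F - {n}. E m ^ k m)"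
      have "n \<in> ?F" using n M by auto
      then have "P M = E n ^ k n * G"
        unfolding P_def G_def by (subst prod.remove[of ?F n]) auto
      then have "absv (poly (P M) v) = absv (v - z n) ^ k n * (absv (b n) * absv (poly (h n) v)) ^ k n
            * absv (poly G v)"
        by (simp only: E_def poly_mult poly_power absv_mult absv_power linear[OF n])
          (simp add: power_mult_distrib)
      also have "\<dots> \<le> absv (v - z n) ^ k n * \<beta> n * (\<Prod>m\<in>?F - {n}. \<beta> m)"
      proof (intro mult_mono mult_left_mono)
        show "(absv (b n) * absv (poly (h n) v)) ^ k n \<le> \<beta> n"
          unfolding \<beta>_def using coeffs_bounded_poly[OF h_bound[OF n], of v] v
          by (intro power_mono mult_left_mono) auto
        have "coeffs_bounded G (\<Prod>m\<in>?F - {n}. \<beta> m)"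
          unfolding G_def using E_bound by (intro coeffs_bounded_prod) auto
        then show "absv (poly G v) \<le> (\<Prod>m\<in>?F - {n}. \<beta> m)"
          using v by (intro coeffs_bounded_poly) auto
      qed (auto simp: \<beta>_def)
      also have "\<dots> = absv (v - z n) ^ k n * (\<Prod>m\<in>?F. \<beta> m)"
        using \<open>n \<in> ?F\<close> by (subst prod.remove[of ?F n]) auto
      also have "\<dots> \<le> absv (v - z n) ^ k n * B"
        by (intro mult_left_mono \<beta>) auto
      finally show ?thesis by (simp add: mult.commute)
    qed
    then show "absv (eval_series f v) \<le> B * absv (v - z n) ^ k n"
      using f_lim[OF v] by (intro LIMSEQ_le_const2) blast+
  next
    fix n assume n: "n \<in> C"
    have v: "absv (w n) < 1" using w[OF n] z[OF n] by simp
    have "\<epsilon> * \<delta> \<le> absv (poly (P M) (w n))" if M: "Suc n \<le> M" for M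
    proof -
      let ?F = "C \<inter> {..<M}"
      have "\<epsilon> * \<delta> \<le> \<epsilon> * (\<Prod>m\<in>?F - {n}. absv (z n - z m) ^ k m)"
        using sep[OF n, of "?F - {n}"] \<epsilon> by (intro mult_left_mono) auto
      also have "\<dots> = absv (w n - z n) ^ k n * (\<Prod>m\<in>?F - {n}. absv (w n - z m) ^ k m)"
        using x[OF n] w_z[OF n] by (simp add: w_def[of n])
      also have "\<dots> = (\<Prod>m\<in>?F. absv (w n - z m) ^ k m)"
        using n M by (subst prod.remove[of ?F n]) auto
      also have "\<dots> \<le> (\<Prod>m\<in>?F. absv (poly (E m ^ k m) (w n)))"
      proof (intro prod_mono conjI)
        fix m assume "m \<in> ?F"
        then have m: "m \<in> C" by auto
        have "1 * absv (w n - z m) * 1 \<le> absv (b m) * absv (w n - z m) * absv (poly (h m) (w n))"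
          using b(1)[OF m] lower[OF m n] by (intro mult_mono) (auto simp: h_def)
        then have "absv (w n - z m) ^ k m
            \<le> (absv (b m) * absv (w n - z m) * absv (poly (h m) (w n))) ^ k m"
          by (intro power_mono) auto
        also have "\<dots> = absv (poly (E m ^ k m) (w n))"
          by (simp only: E_def poly_mult poly_power absv_mult absv_power linear[OF m])
        finally show "absv (w n - z m) ^ k m \<le> absv (poly (E m ^ k m) (w n))" .
      qed simp
      also have "\<dots> = absv (poly (P M) (w n))"
        by (simp add: P_def poly_prod absv_prod)
      finally show ?thesis .
    qed
    then have "\<epsilon> * \<delta> \<le> absv (eval_series f (w n))"
      using f_lim[OF v] by (intro LIMSEQ_le_const) blast+
    then show "\<epsilon> * \<delta> \<le> absv (eval_series f (z n + x n))" by (simp add: w_def)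
  qed
qed

section \<open>Limits along ultrafilters\<close>

text \<open>By compactness the image ultrafilter has a cluster point, to which it must converge.\<close>
lemma ultrafilter_tendsto_compact:
  assumes "ultrafilter u" "compact K" "\<forall>\<^sub>F n in u. g n \<in> K"
  obtains L where "L \<in> K" "(g \<longlongrightarrow> L) u"
proof -
  have "filtermap g u \<noteq> bot" "eventually (\<lambda>x. x \<in> K) (filtermap g u)"
    using assms(1,3) by (auto simp: ultrafilter_def filtermap_bot_iff eventually_filtermap)
  then obtain L where L: "L \<in> K" "inf (nhds L) (filtermap g u) \<noteq> bot"
    using assms(2) compact_filter by blast
  have "(g \<longlongrightarrow> L) u"
    unfolding filterlim_def le_filter_def
  proof (intro allI impI)
    fix P assume P: "eventually P (nhds L)"
    have "eventually (\<lambda>n. P (g n)) u \<or> eventually (\<lambda>n. \<not> P (g n)) u"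
      using assms(1) unfolding ultrafilter_def by (auto dest!: spec[of _ "{n. P (g n)}"])
    moreover have False if "eventually (\<lambda>n. \<not> P (g n)) u"
    proof -
      have "eventually (\<lambda>_. False) (inf (nhds L) (filtermap g u))"
        unfolding eventually_inf eventually_filtermap
        using P that by (intro exI[of _ P] exI[of _ "\<lambda>x. \<not> P x"]) auto
      with L(2) show False by (simp add: trivial_limit_def)
    qed
    ultimately show "eventually P (filtermap g u)" by (auto simp: eventually_filtermap)
  qed
  with L(1) show thesis using that by blast
qed

lemma nonprincipal_ultrafilter_cofinite:
  assumes "nonprincipal_ultrafilter u" "finite A"
  shows "\<forall>\<^sub>F n in u. n \<notin> A"
proof -
  have "\<forall>\<^sub>F n in u. n \<noteq> i" for i
    using assms(1) unfolding nonprincipal_ultrafilter_def ultrafilter_def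
    by (auto dest!: spec[of _ "{i}"] spec[of _ i])
  then have "\<forall>\<^sub>F n in u. \<forall>i\<in>A. n \<noteq> i"
    using assms(2) by (simp add: eventually_ball_finite_distrib)
  then show ?thesis by (rule eventually_mono) blast
qed

section \<open>The seminorms\<close>

lemma cball_subset_unit_disk:
  fixes a :: "'a::complete_nonarch_alg_closed_field"
  assumes "absv a < 1" "\<rho> < 1"
  shows "cball a \<rho> \<subseteq> unit_disk"
proof
  fix w assume "w \<in> cball a \<rho>"
  then have "absv (a - w) < 1" using assms(2) by (simp add: dist_absv)
  then show "w \<in> unit_disk"
    using absv_diff_le[of a "a - w"] assms(1) by simp
qed

lemma Hinf_bdd_above:
  assumes "f \<in> Hinf" "D \<subseteq> unit_disk"
  shows "bdd_above ((\<lambda>w. absv (eval_series f w)) ` D)"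
  using assms(1) by (intro bdd_above_mono[OF _ image_mono[OF assms(2)]]) (simp add: Hinf_def)

lemma zeta_disk_mono:
  assumes "f \<in> Hinf" "D \<subseteq> D'" "D' \<subseteq> unit_disk" "D \<noteq> {}"
  shows "zeta_disk D f \<le> zeta_disk D' f"
  unfolding zeta_disk_def using assms by (intro cSUP_subset_mono Hinf_bdd_above) auto

lemma zeta_disk_ge:
  assumes "f \<in> Hinf" "D \<subseteq> unit_disk" "w \<in> D"
  shows "absv (eval_series f w) \<le> zeta_disk D f"
  unfolding zeta_disk_def using assms by (intro cSUP_upper Hinf_bdd_above) auto

context
  fixes u :: "nat filter" and z :: "nat \<Rightarrow> 'a::complete_nonarch_alg_closed_field"
    and f :: "'a fps"
  assumes u: "ultrafilter u" and z: "\<And>n. absv (z n) < 1" and f: "f \<in> Hinf"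
begin

lemma u_nontrivial: "u \<noteq> bot"
  using u by (simp add: ultrafilter_def)

lemma root_cball:
  fixes k :: nat
  assumes "1 \<le> k" "0 < r" "r < 1"
  shows "cball (z n) (root k r) \<subseteq> unit_disk" "z n \<in> cball (z n) (root k r)"
proof -
  have root: "0 < root k r" "root k r < 1"
    using assms by simp_all
  show "cball (z n) (root k r) \<subseteq> unit_disk"
    by (rule cball_subset_unit_disk[OF z root(2)])
  show "z n \<in> cball (z n) (root k r)"
    using root(1) by simp
qed

lemma zeta_lim_tendsto:
  assumes k: "\<And>n. 1 \<le> k n" and r: "0 < r" "r < 1"
  shows "((\<lambda>n. zeta_disk (cball (z n) (root (k n) r)) f) \<longlongrightarrow> zeta_lim u z k r f) u"
    and "zeta_lim u z k r f \<in> {0..zeta_disk unit_disk f}"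
proof -
  have "zeta_disk (cball (z n) (root (k n) r)) f \<in> {0..zeta_disk unit_disk f}" for n
  proof -
    note cball = root_cball[OF k r, of n n]
    have "0 \<le> zeta_disk (cball (z n) (root (k n) r)) f"
      using zeta_disk_ge[OF f cball] absv_nonneg order_trans by blast
    moreover have "zeta_disk (cball (z n) (root (k n) r)) f \<le> zeta_disk unit_disk f"
      using cball(2) by (intro zeta_disk_mono[OF f cball(1)]) auto
    ultimately show ?thesis by simp
  qed
  then have mem: "\<forall>\<^sub>F n in u. zeta_disk (cball (z n) (root (k n) r)) f \<in> {0..zeta_disk unit_disk f}"
    by simp
  obtain L where L: "L \<in> {0..zeta_disk unit_disk f}"
    "((\<lambda>n. zeta_disk (cball (z n) (root (k n) r)) f) \<longlongrightarrow> L) u"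
    using ultrafilter_tendsto_compact[OF u compact_Icc mem] by blast
  then have "zeta_lim u z k r f = L"
    unfolding zeta_lim_def by (intro tendsto_Lim u_nontrivial)
  with L show "((\<lambda>n. zeta_disk (cball (z n) (root (k n) r)) f) \<longlongrightarrow> zeta_lim u z k r f) u"
    "zeta_lim u z k r f \<in> {0..zeta_disk unit_disk f}" by simp_all
qed

lemma zeta_lim_mono:
  assumes k: "\<And>n. 1 \<le> k n" and l: "\<And>n. 1 \<le> l n" and r: "0 < r" "r < 1" and s: "0 < s" "s < 1"
    and le: "\<forall>\<^sub>F n in u. root (l n) s \<le> root (k n) r"
  shows "zeta_lim u z l s f \<le> zeta_lim u z k r f"
proof (rule tendsto_le[OF u_nontrivial zeta_lim_tendsto(1)[OF k r] zeta_lim_tendsto(1)[OF l s]])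
  show "\<forall>\<^sub>F n in u. zeta_disk (cball (z n) (root (l n) s)) f \<le> zeta_disk (cball (z n) (root (k n) r)) f"
    using le
  proof eventually_elim
    case (elim n)
    then show ?case
      using root_cball[OF k r, of n n] root_cball(2)[OF l s, of n n]
      by (intro zeta_disk_mono f subset_cball) auto
  qed
qed

text \<open>The limit for \<open>r \<rightarrow> 1\<close> is the supremum over \<open>r\<close>, by monotonicity.\<close>
lemma zeta_lim1_eq_0_iff:
  assumes k: "\<And>n. 1 \<le> k n"
  shows "zeta_lim1 u z k f = 0 \<longleftrightarrow> (\<forall>r\<in>{0<..<1}. zeta_lim u z k r f = 0)"
proof -
  let ?g = "\<lambda>r. zeta_lim u z k r f"
  let ?S = "?g ` {0<..<1}"
  have bounds: "?g r \<in> {0..zeta_disk unit_disk f}" if "0 < r" "r < 1" for r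
    by (rule zeta_lim_tendsto(2)[OF k that])
  have I: "{..<1} \<inter> {0<..} = {0<..<(1::real)}" by auto
  have at: "at 1 within {0<..<1} = at_left (1::real)"
    by (rule at_within_nhd[of _ "{0<..}"]) auto
  have "(?g \<longlongrightarrow> Sup (?g ` ({..<1} \<inter> {0<..}))) (at 1 within ({..<1} \<inter> {0<..}))"
  proof (rule Lim_left_bound)
    fix a b :: real
    assume "a \<in> {0<..}" "b \<in> {0<..}" "b < 1" "a \<le> b"
    then show "?g a \<le> ?g b"
      using k by (intro zeta_lim_mono) (auto intro!: always_eventually real_root_le_mono simp: Suc_le_eq)
  next
    fix b :: real
    assume "b \<in> {0<..}" "b < 1"
    then show "?g b \<le> zeta_disk unit_disk f" using bounds[of b] by simp
  qed
  then have "(?g \<longlongrightarrow> Sup ?S) (at_left 1)"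
    by (simp only: I at)
  then have eq: "zeta_lim1 u z k f = Sup ?S"
    unfolding zeta_lim1_def by (intro tendsto_Lim trivial_limit_at_left_real)
  have bdd: "bdd_above ?S"
    using bounds by (intro bdd_aboveI2[of _ _ "zeta_disk unit_disk f"]) auto
  show ?thesis
  proof
    assume "zeta_lim1 u z k f = 0"
    then have "?g r \<le> 0" if "r \<in> {0<..<1}" for r
      using cSUP_upper[OF that bdd] eq by simp
    then show "\<forall>r\<in>{0<..<1}. ?g r = 0"
      using bounds by (force intro: antisym)
  next
    assume "\<forall>r\<in>{0<..<1}. ?g r = 0"
    then have "?S = (\<lambda>r. 0) ` {0<..<1::real}" by (intro image_cong) auto
    then show "zeta_lim1 u z k f = 0" by (simp add: eq image_constant_conv)
  qed
qed

end

section \<open>Compatible sequences of exponents\<close>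

text \<open>The partial products decrease to the limit.\<close>
lemma inf_prod_bounds:
  assumes a: "\<And>m. 0 \<le> a m" "\<And>m. a m \<le> 1"
  shows "0 \<le> inf_prod A a" and "finite F \<Longrightarrow> F \<subseteq> A \<Longrightarrow> inf_prod A a \<le> prod a F"
proof -
  define p where "p M = (\<Prod>m\<in>A \<inter> {..<M}. a m)" for M
  have le: "prod a G \<le> prod a F" if "F \<subseteq> G" "finite G" for F G
  proof -
    have "prod a G = prod a (G - F) * prod a F"
      using that by (simp add: prod.subset_diff)
    also have "\<dots> \<le> 1 * prod a F"
      using a by (intro mult_right_mono prod_le_1 prod_nonneg) auto
    finally show ?thesis by simp
  qed
  have decr: "decseq p"
    unfolding decseq_def p_def by (auto intro!: le)
  have p_nonneg: "0 \<le> p M" for M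
    unfolding p_def using a by (intro prod_nonneg) auto
  have "convergent p"
    using decseq_convergent[OF decr, of 0] p_nonneg unfolding convergent_def by blast
  then have lim: "p \<longlonglongrightarrow> inf_prod A a"
    by (simp add: inf_prod_def p_def[abs_def] convergent_LIMSEQ_iff)
  show "0 \<le> inf_prod A a"
    using LIMSEQ_le_const[OF lim] p_nonneg by blast
  assume F: "finite F" "F \<subseteq> A"
  then obtain M where "F \<subseteq> {..<M}"
    using finite_nat_iff_bounded[of F] by auto
  then show "inf_prod A a \<le> prod a F"
    using decseq_ge[OF decr lim, of M] le[of F "A \<inter> {..<M}"] F by (auto simp: p_def)
qed

lemma Comp_separated:
  fixes z :: "nat \<Rightarrow> 'a::complete_nonarch_alg_closed_field"
  assumes "k \<in> Comp u z" and z: "\<And>n. absv (z n) < 1"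
  obtains C \<delta> where "\<forall>\<^sub>F n in u. n \<in> C" "0 < \<delta>"
    "\<And>n F. n \<in> C \<Longrightarrow> finite F \<Longrightarrow> F \<subseteq> C - {n} \<Longrightarrow> \<delta> \<le> (\<Prod>m\<in>F. absv (z n - z m) ^ k m)"
proof -
  obtain C where C: "\<forall>\<^sub>F n in u. n \<in> C"
    "0 < (INF n\<in>C. inf_prod (C - {n}) (\<lambda>m. absv (z n - z m) ^ k m))" (is "0 < ?\<delta>")
    using assms(1) by (auto simp: Comp_def)
  have pow: "absv (z n - z m) ^ k m \<le> 1" for n m
    using absv_diff_le[of "z n" "z m"] z[of n] z[of m] by (intro power_le_one) auto
  have "?\<delta> \<le> (\<Prod>m\<in>F. absv (z n - z m) ^ k m)" if "n \<in> C" "finite F" "F \<subseteq> C - {n}" for n F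
  proof -
    have "?\<delta> \<le> inf_prod (C - {n}) (\<lambda>m. absv (z n - z m) ^ k m)"
      using that(1) pow by (intro cINF_lower bdd_belowI2[of _ 0] inf_prod_bounds(1)) auto
    also have "\<dots> \<le> (\<Prod>m\<in>F. absv (z n - z m) ^ k m)"
      using that pow by (intro inf_prod_bounds(2)) auto
    finally show ?thesis .
  qed
  with C show thesis using that by blast
qed

text \<open>
  All points of larger absolute value than a fixed \<open>z i\<close> satisfy \<open>\<bar>z m\<bar> = \<bar>z i - z m\<bar>\<close>, and all
  but finitely many points are of this kind.
\<close>
lemma Comp_separated_center:
  fixes z :: "nat \<Rightarrow> 'a::complete_nonarch_alg_closed_field"
  assumes u: "nonprincipal_ultrafilter u" and k: "k \<in> Comp u z" and z: "\<And>n. absv (z n) < 1"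
  obtains C \<delta> where "\<forall>\<^sub>F n in u. n \<in> C" "0 < \<delta>"
    "\<And>n F. n \<in> C \<Longrightarrow> finite F \<Longrightarrow> F \<subseteq> C - {n} \<Longrightarrow> \<delta> \<le> (\<Prod>m\<in>F. absv (z n - z m) ^ k m)"
    "\<And>F. finite F \<Longrightarrow> F \<subseteq> C \<Longrightarrow> \<delta> \<le> (\<Prod>m\<in>F. absv (z m) ^ k m)"
proof -
  obtain C \<delta> where C: "\<forall>\<^sub>F n in u. n \<in> C" and \<delta>: "0 < \<delta>"
    and sep: "\<And>n F. n \<in> C \<Longrightarrow> finite F \<Longrightarrow> F \<subseteq> C - {n} \<Longrightarrow> \<delta> \<le> (\<Prod>m\<in>F. absv (z n - z m) ^ k m)"
    using Comp_separated[OF k z] by blast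
  have k1: "1 \<le> k n" for n using k by (simp add: Comp_def)
  have "u \<noteq> bot" using u by (simp add: nonprincipal_ultrafilter_def ultrafilter_def)
  then obtain i where i: "i \<in> C"
    using C eventually_happens' by blast
  define C' where "C' = {m \<in> C. absv (z i) < absv (z m)}"
  define A where "A = C - C' - {i}"
  have "finite A"
  proof (rule finite_if_prod_bounded_below[of "absv (z i)" \<delta>])
    show "\<delta> \<le> (\<Prod>m\<in>F. absv (z i - z m) ^ k m)" if "finite F" "F \<subseteq> A" for F
      using that by (intro sep i) (auto simp: A_def)
    fix m assume "m \<in> A"
    then have "absv (z i - z m) \<le> absv (z i)"
      using absv_diff_le[of "z i" "z m"] by (auto simp: A_def C'_def)
    moreover have "absv (z i - z m) ^ k m \<le> absv (z i - z m) ^ 1"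
      using absv_diff_le[of "z i" "z m"] z[of i] z[of m] k1 by (intro power_decreasing) auto
    ultimately show "0 \<le> absv (z i - z m) ^ k m \<and> absv (z i - z m) ^ k m \<le> absv (z i)" by simp
  qed (use z \<delta> in auto)
  then have "\<forall>\<^sub>F n in u. n \<notin> insert i A"
    by (intro nonprincipal_ultrafilter_cofinite u) simp
  with C have "\<forall>\<^sub>F n in u. n \<in> C'"
    by eventually_elim (auto simp: A_def)
  moreover have "\<delta> \<le> (\<Prod>m\<in>F. absv (z m) ^ k m)" if F: "finite F" "F \<subseteq> C'" for F
  proof -
    have "\<delta> \<le> (\<Prod>m\<in>F. absv (z i - z m) ^ k m)"
      using F by (intro sep i) (auto simp: C'_def)
    also have "\<dots> = (\<Prod>m\<in>F. absv (z m) ^ k m)"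
    proof (intro prod.cong refl)
      fix m assume "m \<in> F"
      then have "absv (z i - z m) = absv (z m)"
        using F by (intro absv_diff_eq_right) (auto simp: C'_def)
      then show "absv (z i - z m) ^ k m = absv (z m) ^ k m" by simp
    qed
    finally show ?thesis .
  qed
  ultimately show thesis
    using \<delta> sep by (intro that[of C' \<delta>]) (auto simp: C'_def)
qed

section \<open>Comparison of the two kernels\<close>

text \<open>\<open>s\<^bsup>1/l\<^esup> = (s\<^bsup>k/l\<^esup>)\<^bsup>1/k\<^esup>\<close>, where \<open>k / l\<close> tends to infinity.\<close>
lemma root_power_tendsto_0:
  fixes k l :: "'i \<Rightarrow> nat"
  assumes lim: "((\<lambda>n. real (l n) / real (k n)) \<longlongrightarrow> 0) u"
    and k: "\<And>n. 1 \<le> k n" and l: "\<And>n. 1 \<le> l n" and s: "0 < s" "s < 1"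
  shows "((\<lambda>n. root (l n) s ^ k n) \<longlongrightarrow> 0) u"
proof -
  have pos: "0 < real (l n) / real (k n)" for n
    using k[of n] l[of n] by simp
  have "LIM n u. inverse (real (l n) / real (k n)) :> at_top"
    using pos by (intro filterlim_inverse_at_top lim) simp
  then have "LIM n u. inverse (real (l n) / real (k n)) * - ln s :> at_top"
    using s by (intro filterlim_at_top_mult_tendsto_pos[OF tendsto_const]) auto
  then have "((\<lambda>n. exp (- (inverse (real (l n) / real (k n)) * - ln s))) \<longlongrightarrow> 0) u"
    by (intro filterlim_compose[OF exp_at_bot]) (simp add: filterlim_uminus_at_top)
  moreover have "exp (- (inverse (real (l n) / real (k n)) * - ln s)) = root (l n) s ^ k n" for n
  proof -
    have "root (l n) s = exp (ln s / real (l n))"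
      using l[of n] s by (simp add: root_powr_inverse powr_def)
    then show ?thesis
      by (simp flip: exp_of_nat_mult)
  qed
  ultimately show ?thesis by simp
qed

theorem corollary2p6:
  fixes z :: "nat \<Rightarrow> 'a::complete_nonarch_alg_closed_field"
    and u :: "nat filter"
    and k l :: "nat \<Rightarrow> nat"
  assumes "nonprincipal_ultrafilter u"
    and "\<And>n. z n \<in> unit_disk"
    and "regular_wrt u z"
    and "k \<in> Comp u z"
    and "l \<in> Comp u z"
    and "((\<lambda>n. real (l n) / real (k n)) \<longlongrightarrow> 0) u"
  shows "seminorm_ker (zeta_lim1 u z k) \<subset> seminorm_ker (zeta_lim1 u z l)"
proof -
  have u: "ultrafilter u" using assms(1) by (simp add: nonprincipal_ultrafilter_def)
  then have nontriv: "u \<noteq> bot" by (simp add: ultrafilter_def)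
  have z: "absv (z n) < 1" for n using assms(2) by simp
  have k: "1 \<le> k n" and l: "1 \<le> l n" for n
    using assms(4,5) by (simp_all add: Comp_def)
  note power_lim = root_power_tendsto_0[OF assms(6) k l]

  have "seminorm_ker (zeta_lim1 u z k) \<subseteq> seminorm_ker (zeta_lim1 u z l)"
  proof
    fix f assume "f \<in> seminorm_ker (zeta_lim1 u z k)"
    then have f: "f \<in> Hinf" and zero: "zeta_lim u z k r f = 0" if "r \<in> {0<..<1}" for r
      using zeta_lim1_eq_0_iff[where z = z and k = k, OF u z _ k] that by (auto simp: seminorm_ker_def)
    have f: "f \<in> Hinf" using f[of "1/2"] by simp
    have "zeta_lim u z l s f = 0" if s: "0 < s" "s < 1" for s
    proof -
      have "\<forall>\<^sub>F n in u. root (l n) s ^ k n < 1 / 2"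
        using power_lim[OF s] by (rule order_tendstoD) simp
      then have "\<forall>\<^sub>F n in u. root (l n) s \<le> root (k n) (1 / 2)"
      proof eventually_elim
        case (elim n)
        have "root (l n) s = root (k n) (root (l n) s ^ k n)"
          using k[of n] l[of n] s by (simp add: real_root_power_cancel)
        then show ?case
          using k[of n] elim by (metis less_imp_le less_le_trans real_root_le_iff zero_less_one)
      qed
      then have "zeta_lim u z l s f \<le> zeta_lim u z k (1 / 2) f"
        using s by (intro zeta_lim_mono[OF u z f k l]) auto
      then show ?thesis
        using zero[of "1/2"] zeta_lim_tendsto(2)[where z = z and k = l, OF u z f l s] by simp
    qed
    then show "f \<in> seminorm_ker (zeta_lim1 u z l)"
      using f zeta_lim1_eq_0_iff[where z = z and k = l, OF u z f l] by (simp add: seminorm_ker_def)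
  qed
  moreover have "\<exists>f. f \<in> seminorm_ker (zeta_lim1 u z l) \<and> f \<notin> seminorm_ker (zeta_lim1 u z k)"
  proof -
    obtain C \<delta> where C: "\<forall>\<^sub>F n in u. n \<in> C" and \<delta>: "0 < \<delta>"
      and sep: "\<And>n F. n \<in> C \<Longrightarrow> finite F \<Longrightarrow> F \<subseteq> C - {n} \<Longrightarrow> \<delta> \<le> (\<Prod>m\<in>F. absv (z n - z m) ^ k m)"
      and center: "\<And>F. finite F \<Longrightarrow> F \<subseteq> C \<Longrightarrow> \<delta> \<le> (\<Prod>m\<in>F. absv (z m) ^ k m)"
      using Comp_separated_center[OF assms(1,4) z] by blast
    \<comment> \<open>offsets \<open>x n\<close> with \<open>\<bar>x n\<bar>\<^bsup>k n\<^esup> = \<bar>e\<bar>\<close> for all \<open>n\<close>, so that \<open>z n + x n\<close> lies in the disk of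
      radius \<open>\<bar>e\<bar>\<^bsup>1/k n\<^esup>\<close>; roots exist because the field is algebraically closed\<close>
    obtain e :: 'a where e: "e \<noteq> 0" "absv e < \<delta>" "absv e < 1"
      using exists_absv_small[OF \<delta>] by metis
    have "\<exists>y. y ^ k n = e" for n
      using k[of n] by (intro nth_root_exists) simp
    then obtain x where x: "\<And>n. x n ^ k n = e" by metis
    have x': "absv (x n) ^ k n = absv e" for n
      by (simp add: x flip: absv_power)
    obtain f B where f: "f \<in> Hinf"
      and upper: "\<And>n w. n \<in> C \<Longrightarrow> absv w < 1 \<Longrightarrow> absv (eval_series f w) \<le> B * absv (w - z n) ^ k n"
      and lower: "\<And>n. n \<in> C \<Longrightarrow> absv e * \<delta> \<le> absv (eval_series f (z n + x n))"
      using bounded_product_with_zeros[of C z k \<delta> x "absv e"] z k center sep x' e by auto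
    have "zeta_lim u z l s f = 0" if s: "0 < s" "s < 1" for s
    proof -
      have "((\<lambda>n. zeta_disk (cball (z n) (root (l n) s)) f) \<longlongrightarrow> 0) u"
      proof (rule tendsto_sandwich[OF _ _ tendsto_const])
        show "((\<lambda>n. \<bar>B\<bar> * root (l n) s ^ k n) \<longlongrightarrow> 0) u"
          by (intro tendsto_mult_right_zero power_lim s)
        show "\<forall>\<^sub>F n in u. zeta_disk (cball (z n) (root (l n) s)) f \<le> \<bar>B\<bar> * root (l n) s ^ k n"
          using C
        proof eventually_elim
          case (elim n)
          note cball = root_cball[where z = z, OF u z f l s, of n n]
          show ?case
            unfolding zeta_disk_def
          proof (rule cSUP_least)
            fix w assume w: "w \<in> cball (z n) (root (l n) s)"
            have "absv (eval_series f w) \<le> B * absv (w - z n) ^ k n"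
              using cball w by (intro upper elim) auto
            also have "\<dots> \<le> \<bar>B\<bar> * root (l n) s ^ k n"
              using w by (intro mult_mono power_mono) (auto simp: dist_absv absv_minus_commute)
            finally show "absv (eval_series f w) \<le> \<bar>B\<bar> * root (l n) s ^ k n" .
          qed (use cball in auto)
        qed
        have "0 \<le> zeta_disk (cball (z n) (root (l n) s)) f" for n
          using zeta_disk_ge[OF f root_cball[where z = z, OF u z f l s, of n n]] absv_nonneg order_trans by blast
        then show "\<forall>\<^sub>F n in u. 0 \<le> zeta_disk (cball (z n) (root (l n) s)) f" by simp
      qed
      then show ?thesis
        using tendsto_unique[OF nontriv] zeta_lim_tendsto(1)[where z = z and k = l, OF u z f l s] by blast
    qed
    then have "f \<in> seminorm_ker (zeta_lim1 u z l)"
      using f zeta_lim1_eq_0_iff[where z = z and k = l, OF u z f l] by (simp add: seminorm_ker_def)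
    moreover have "absv e * \<delta> \<le> zeta_lim u z k (absv e) f"
    proof (rule tendsto_lowerbound[OF zeta_lim_tendsto(1)[where z = z and k = k, OF u z f k] _ nontriv])
      show "\<forall>\<^sub>F n in u. absv e * \<delta> \<le> zeta_disk (cball (z n) (root (k n) (absv e))) f"
        using C
      proof eventually_elim
        case (elim n)
        have "root (k n) (absv e) = absv (x n)"
          using k[of n] by (simp add: real_root_power_cancel flip: x'[of n])
        then have "z n + x n \<in> cball (z n) (root (k n) (absv e))"
          by (simp add: dist_absv)
        then show ?case
          using lower[OF elim] zeta_disk_ge[OF f root_cball(1)[where z = z, OF u z f k]] e
          by (meson absv_pos_iff order_trans)
      qed
    qed (use e in auto)
    then have "zeta_lim u z k (absv e) f \<noteq> 0"
      using e \<delta> by (metis absv_pos_iff mult_pos_pos not_le)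
    then have "f \<notin> seminorm_ker (zeta_lim1 u z k)"
      using e zeta_lim1_eq_0_iff[where z = z and k = k, OF u z f k] by (auto simp: seminorm_ker_def)
    ultimately show ?thesis by blast
  qed
  ultimately show ?thesis by blast
qed

end
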